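(* Let $n\ge2$ and let $P$ be a regular game on $n$ players. Then $P$ is transitive if and only if there exists a vector $u^{\mathcal T}\in\mathbb R^n$ such that $\mathrm{Disk}(u^{\mathcal T},\mathbf 1)$ achieves the sign-rank of $P$, i.e. $P\sim\mathrm{Disk}(u^{\mathcal T},\mathbf 1)$. In particular, any regular transitive game has sign-rank two, and the vector $u^{\mathcal T}$ can be chosen as the Elo rating of $\varphi_\beta(P)$, where $\varphi_\beta(x):=\frac1\beta\tanh(\beta x)$ and $\beta>\max\left(\frac{n-1}{x_\alpha},\beta_\alpha\right)$, with $\alpha$, $x_\alpha$, $\beta_\alpha$ as defined in the context.
   Context: A game on $n$ players is an antisymmetric real $n\times n$ matrix $P$ ($P=-P^T$) with entries in $[-1,1]$. Put $\widetilde P_{ij}:=\frac{1+P_{ij}}{2}$. $P$ is regular if $P_{ij}\neq0$ for all $i\ne j$. $P$ is transitive if, for all $i,j,k$, $P_{ij}>0$ and $P_{jk}>0$ imply $P_{ik}>0$. For antisymmetric matrices $P,Q$ of the same size, $P\sim Q$ means that $P_{ij}>0\Leftrightarrow Q_{ij}>0$ for all $i,j$. For $u,v\in\mathbb R^n$, $\mathrm{Disk}(u,v):=uv^T-vu^T$. $\mathbf 1\in\mathbb R^n$ is the all-ones vector. The sign-rank of an antisymmetric matrix $P$ is the minimum rank of a real antisymmetric matrix $Q$ with $Q\sim P$. A matrix $Q$ achieves the sign-rank of $P$ if $Q\sim P$ and $\mathrm{rank}(Q)$ equals the sign-rank of $P$. Let $\sigma(x)=(1+e^{-x})^{-1}$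 and $\mathrm{bce}(y,\hat y):=-y\ln\hat y-(1-y)\ln(1-\hat y)$. The Elo rating $\varepsilon^P\in\mathbb R^n$ of a game $P$ is a minimizer over $\varepsilon\in\mathbb R^n$ of $\sum_{i,j}\mathrm{bce}\left(\widetilde P_{ij},\sigma(\varepsilon_i-\varepsilon_j)\right)$. A real function applied to a matrix is applied entrywise. Parameters (for $P$ regular and transitive): $\alpha$ is any number with $0<\alpha<\frac{2}{n(n-1)}$; $x_\alpha$ is the unique positive root of $2\,\mathrm{arctanh}^3(x)-3\alpha x$; with $P_{max}:=\max_{i,j}P_{ij}$ and $P_{min}:=\min_{(i,j):\,P_{ij}>0}P_{ij}$, $\beta_\alpha>0$ is any number such that $\frac{\tanh(\beta_\alpha P_{max})}{\tanh(\beta_\alpha P_{min})}\le\frac{n}{n-2+n(n-1)\alpha}$. *)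

theory Defs
  imports "HOL-Analysis.Analysis"
begin

definition antisymmetric :: "real^'n^'n \<Rightarrow> bool" where
  "antisymmetric P \<longleftrightarrow> P = - transpose P"

definition is_game :: "real^'n^'n \<Rightarrow> bool" where
  "is_game P \<longleftrightarrow> antisymmetric P \<and> (\<forall>i j. P $ i $ j \<in> {-1..1})"

definition regular_game :: "real^'n^'n \<Rightarrow> bool" where
  "regular_game P \<longleftrightarrow> (\<forall>i j. i \<noteq> j \<longrightarrow> P $ i $ j \<noteq> 0)"

definition transitive_game :: "real^'n^'n \<Rightarrow> bool" where
  "transitive_game P \<longleftrightarrow>
     (\<forall>i j k. P $ i $ j > 0 \<and> P $ j $ k > 0 \<longrightarrow> P $ i $ k > 0)"

text \<open>Only meaningful for antisymmetric matrices, where agreement on the positive entries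
  already forces agreement of all signs.\<close>

definition sign_equiv :: "real^'n^'n \<Rightarrow> real^'n^'n \<Rightarrow> bool"  (infix \<open>\<sim>\<^sub>s\<close> 50) where
  "P \<sim>\<^sub>s Q \<longleftrightarrow> (\<forall>i j. P $ i $ j > 0 \<longleftrightarrow> Q $ i $ j > 0)"

definition Disk :: "real^'n \<Rightarrow> real^'n \<Rightarrow> real^'n^'n" where
  "Disk u v = (columnvector u :: real^1^'n) ** (rowvector v :: real^'n^1)
            - (columnvector v :: real^1^'n) ** (rowvector u :: real^'n^1)"

lemma Disk_nth: "Disk u v $ i $ j = u $ i * v $ j - v $ i * u $ j"
  by (simp add: Disk_def matrix_matrix_mult_def columnvector_def rowvector_def)

text \<open>The minimum ranges over a nonempty set when \<open>P\<close> is antisymmetric, because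
  \<open>P\<close> itself is then a candidate.\<close>

definition sign_rank :: "real^'n^'n \<Rightarrow> nat" where
  "sign_rank P = (LEAST r. \<exists>Q. antisymmetric Q \<and> Q \<sim>\<^sub>s P \<and> rank Q = r)"

definition achieves_sign_rank :: "real^'n^'n \<Rightarrow> real^'n^'n \<Rightarrow> bool" where
  "achieves_sign_rank Q P \<longleftrightarrow> antisymmetric Q \<and> Q \<sim>\<^sub>s P \<and> rank Q = sign_rank P"

definition sigmoid :: "real \<Rightarrow> real" where
  "sigmoid x = inverse (1 + exp (- x))"

definition bce :: "real \<Rightarrow> real \<Rightarrow> real" where
  "bce y z = - y * ln z - (1 - y) * ln (1 - z)"

definition elo_loss :: "real^'n^'n \<Rightarrow> real^'n \<Rightarrow> real" where
  "elo_loss P e = (\<Sum>i\<in>UNIV. \<Sum>j\<in>UNIV. bce ((1 + P $ i $ j) / 2) (sigmoid (e $ i - e $ j)))"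

text \<open>A relation rather than a function: the loss is invariant under adding a constant to
  all ratings, so a minimizer is never unique.\<close>

definition elo_rating :: "real^'n^'n \<Rightarrow> real^'n \<Rightarrow> bool" where
  "elo_rating P e \<longleftrightarrow> is_arg_min (elo_loss P) (\<lambda>_. True) e"

definition phi :: "real \<Rightarrow> real \<Rightarrow> real" where
  "phi b x = (1 / b) * tanh (b * x)"

definition P_max :: "real^'n^'n \<Rightarrow> real" where
  "P_max P = Max {P $ i $ j | i j. True}"

definition P_min :: "real^'n^'n \<Rightarrow> real" where
  "P_min P = Min {P $ i $ j | i j. P $ i $ j > 0}"

text \<open>The bound \<open>x < 1\<close> expresses the domain of the inverse hyperbolic tangent; the total
  function \<^const>\<open>artanh\<close> has unspecified meaning outside \<open>(-1, 1)\<close>.\<close>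

definition x_alpha :: "real \<Rightarrow> real" where
  "x_alpha a = (THE x. 0 < x \<and> x < 1 \<and> 2 * artanh x ^ 3 - 3 * a * x = 0)"

lemma artanh_superlinear:
  fixes x y :: real
  assumes "0 < x" "x < y" "y < 1"
  shows "artanh x * y \<le> artanh y * x"
proof -
  have d: "(artanh has_real_derivative 1 / (1 - t ^ 2)) (at t)" if "0 \<le> t" "t \<le> y" for t :: real
    using that assms by (intro artanh_real_has_field_derivative) auto
  obtain c where c: "0 < c" "c < x" "artanh x - artanh 0 = (x - 0) * (1 / (1 - c ^ 2))"
    using MVT2[of 0 x artanh "\<lambda>t. 1 / (1 - t ^ 2)"] d assms by auto
  obtain e where e: "x < e" "e < y" "artanh y - artanh x = (y - x) * (1 / (1 - e ^ 2))"
    using MVT2[of x y artanh "\<lambda>t. 1 / (1 - t ^ 2)"] d assms by auto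
  have "c ^ 2 \<le> e ^ 2" "e ^ 2 < 1"
    using c e assms by (auto intro!: power_mono simp: power_less_one_iff)
  then have "1 / (1 - c ^ 2) \<le> 1 / (1 - e ^ 2)"
    by (intro divide_left_mono) auto
  then have "x * (y - x) * (1 / (1 - c ^ 2)) \<le> x * (y - x) * (1 / (1 - e ^ 2))"
    using assms by (intro mult_left_mono) auto
  then have "artanh x * (y - x) \<le> x * (artanh y - artanh x)"
    using c(3) e(3) by (simp add: mult_ac)
  then show ?thesis by (simp add: algebra_simps)
qed

lemma x_alpha_root_less_False:
  fixes x y a :: real
  assumes "0 < a" "0 < x" "x < y" "y < 1"
    and "2 * artanh x ^ 3 - 3 * a * x = 0" "2 * artanh y ^ 3 - 3 * a * y = 0"
  shows False
proof -
  have p: "artanh x ^ 3 = (3 * a / 2) * x" "artanh y ^ 3 = (3 * a / 2) * y"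
    using assms by auto
  have "artanh x ^ 3 > 0" unfolding p(1) using assms by (intro mult_pos_pos) auto
  then have "artanh x > 0" by (simp add: zero_less_power_eq)
  then have "(artanh x * y) ^ 3 \<le> (artanh y * x) ^ 3"
    using artanh_superlinear[of x y] assms by (intro power_mono) auto
  then have "(3 * a / 2 * x * y) * y ^ 2 \<le> (3 * a / 2 * x * y) * x ^ 2"
    unfolding power_mult_distrib p by (simp add: power2_eq_square power3_eq_cube mult_ac)
  moreover have "3 * a / 2 * x * y > 0" using assms by simp
  ultimately have "y ^ 2 \<le> x ^ 2" by (simp only: mult_le_cancel_left_pos)
  moreover have "x ^ 2 < y ^ 2" using assms by (intro power_strict_mono) auto
  ultimately show False by simp
qed

lemma x_alpha_ex1:
  fixes a :: real
  assumes "0 < a"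
  shows "\<exists>!x. 0 < x \<and> x < 1 \<and> 2 * artanh x ^ 3 - 3 * a * x = 0"
proof (rule ex_ex1I)
  define h where "h = (\<lambda>t::real. 2 * t ^ 3 - 3 * a * tanh t)"
  have cont: "continuous_on A h" for A
    unfolding h_def by (intro continuous_intros) auto
  have "(h has_real_derivative - 3 * a) (at 0)"
    unfolding h_def by (auto intro!: derivative_eq_intros)
  then obtain d where d: "d > 0" "\<And>t. 0 < t \<Longrightarrow> t < d \<Longrightarrow> h 0 > h (0 + t)"
    using DERIV_neg_dec_right[of h "- 3 * a" 0] assms by auto
  define s where "s = min (d / 2) 1"
  have s: "0 < s" "s \<le> 1" "h s < 0"
    using d(1) d(2)[of s] by (auto simp: s_def h_def)
  have "(1 + a) ^ 3 = 1 + 3 * a + 3 * a ^ 2 + a ^ 3"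
    by (simp add: power2_eq_square power3_eq_cube algebra_simps)
  then have "2 * (1 + a) ^ 3 \<ge> 3 * a" using assms by simp
  moreover have "3 * a * tanh (1 + a) \<le> 3 * a"
    using assms tanh_real_lt_1[of "1 + a"] by simp
  ultimately have "h (1 + a) \<ge> 0" unfolding h_def by linarith
  then obtain t where t: "s \<le> t" "t \<le> 1 + a" "h t = 0"
    using IVT'[of h s 0 "1 + a"] s assms cont by auto
  then show "\<exists>x. 0 < x \<and> x < 1 \<and> 2 * artanh x ^ 3 - 3 * a * x = 0"
    using s by (intro exI[of _ "tanh t"]) (auto simp: h_def artanh_tanh_real tanh_real_lt_1)
next
  fix x y :: real
  assume "0 < x \<and> x < 1 \<and> 2 * artanh x ^ 3 - 3 * a * x = 0"
    and "0 < y \<and> y < 1 \<and> 2 * artanh y ^ 3 - 3 * a * y = 0"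
  then show "x = y"
    using x_alpha_root_less_False[of a x y] x_alpha_root_less_False[of a y x] assms
    by (cases x y rule: linorder_cases) auto
qed

end

theory Submission
  imports Defs
begin

text \<open>The loss is stationary at an Elo rating \<open>e\<close> of an antisymmetric matrix \<open>P\<close>, which says
  \<open>F (e i) = (\<Sum>k. (1 + P i k) / 2)\<close> for all \<open>i\<close>, where \<open>F x = (\<Sum>k. \<sigma> (x - e k))\<close> is the same
  strictly increasing function for all players. So Elo ratings are always ordered like the row
  sums of the game, and it is enough to compare the row sums of \<open>tanh (\<beta> P)\<close>. If \<open>i\<close> beats \<open>j\<close> in a
  regular transitive game, then \<open>i\<close> has at least one win more than \<open>j\<close>, and the row sums
  differ by at least \<open>n tanh (\<beta> P\<^sub>m\<^sub>i\<^sub>n) - (n - 2) tanh (\<beta> P\<^sub>m\<^sub>a\<^sub>x)\<close>. This is positive at \<open>\<beta> = \<beta>\<^sub>\<alpha>\<close>, and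
  remains so for larger \<open>\<beta>\<close> because \<open>tanh (\<beta> a) / tanh (\<beta> b)\<close> decreases in \<open>\<beta>\<close> for \<open>b \<le> a\<close>.\<close>

section \<open>Antisymmetric matrices and sign rank\<close>

lemma antisymmetric_iff: "antisymmetric P \<longleftrightarrow> (\<forall>i j. P $ i $ j = - P $ j $ i)"
  unfolding antisymmetric_def vec_eq_iff by (simp add: transpose_def)

lemma antisymmetric_nth: "antisymmetric P \<Longrightarrow> P $ i $ j = - P $ j $ i"
  unfolding antisymmetric_iff by blast

lemma antisymmetric_diag: "antisymmetric P \<Longrightarrow> P $ i $ i = 0"
  using antisymmetric_nth[of P i i] by simp

lemma antisymmetric_Disk: "antisymmetric (Disk u v)"
  by (simp add: antisymmetric_iff Disk_nth)

lemma Disk_one_nth: "Disk u 1 $ i $ j = u $ i - u $ j"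
  by (simp add: Disk_nth)

lemma sign_equiv_sym: "P \<sim>\<^sub>s Q \<Longrightarrow> Q \<sim>\<^sub>s P"
  unfolding sign_equiv_def by simp

lemma sign_equiv_Disk_one: "P \<sim>\<^sub>s Disk u 1 \<longleftrightarrow> (\<forall>i j. P $ i $ j > 0 \<longleftrightarrow> u $ j < u $ i)"
  by (simp add: sign_equiv_def Disk_one_nth)

lemma rank_Disk_le: "rank (Disk u v) \<le> 2"
proof -
  have "rows (Disk u v) \<subseteq> span {u, v}"
  proof
    fix r assume "r \<in> rows (Disk u v)"
    then obtain i where "r = row i (Disk u v)" by (auto simp: rows_def)
    then have "r = u $ i *\<^sub>R v - v $ i *\<^sub>R u"
      by (simp add: vec_eq_iff row_def Disk_nth)
    then show "r \<in> span {u, v}"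
      by (simp add: span_base span_diff span_scale)
  qed
  then have "dim (rows (Disk u v)) \<le> card {u, v}"
    by (intro dim_le_card) auto
  also have "\<dots> \<le> 2" by (simp add: card_insert_if)
  finally show ?thesis by (simp add: row_rank_def)
qed

text \<open>On columns \<open>i\<close> and \<open>j\<close>, rows \<open>i\<close> and
  \<open>j\<close> form the block with zero diagonal and off-diagonal entries \<open>q\<close> and
  \<open>- q\<close>, where \<open>q = Q $ i $ j\<close>. It is invertible, so the two rows are
  independent.\<close>

lemma antisymmetric_rank_ge_2:
  assumes "antisymmetric Q" "Q $ i $ j \<noteq> 0"
  shows "2 \<le> rank Q"
proof -
  have z: "Q $ i $ i = 0" "Q $ j $ j = 0" "Q $ j $ i = - Q $ i $ j"
    using assms(1) antisymmetric_diag antisymmetric_nth by blast+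
  have ne: "row i Q \<noteq> row j Q"
    using z assms(2) by (auto simp: vec_eq_iff row_def intro!: exI[of _ j])
  have "row i Q \<notin> span {row j Q}"
  proof
    assume "row i Q \<in> span {row j Q}"
    then obtain c where "row i Q = c *\<^sub>R row j Q" by (auto simp: span_singleton)
    \<comment> \<open>Column \<open>j\<close> decides: row \<open>j\<close> vanishes there by
      antisymmetry, row \<open>i\<close> does not.\<close>
    then have "row i Q $ j = (c *\<^sub>R row j Q) $ j" by simp
    then show False using z assms(2) by (simp add: row_def)
  qed
  moreover have "row j Q \<noteq> 0"
    using z assms(2) by (auto simp: vec_eq_iff row_def intro!: exI[of _ i])
  ultimately have "independent {row i Q, row j Q}"
    using ne by (simp add: independent_insert)
  moreover have "{row i Q, row j Q} \<subseteq> span (rows Q)"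
    by (auto simp: rows_def intro!: span_base)
  ultimately have "card {row i Q, row j Q} \<le> dim (rows Q)"
    by (metis dim_span independent_card_le_dim)
  then show ?thesis using ne by (simp add: row_rank_def)
qed

text \<open>Sign equivalence forces every candidate to be nonzero where \<open>P\<close> is
  positive, so its rank is at least 2; a disk matrix has rank at most 2 and attains this.\<close>

lemma sign_rank_eq_2:
  assumes "antisymmetric P" "P $ i $ j \<noteq> 0" "P \<sim>\<^sub>s Disk u 1"
  shows "sign_rank P = 2" "rank (Disk u 1) = 2"
proof -
  have ge: "2 \<le> rank Q" if "antisymmetric Q" "Q \<sim>\<^sub>s P" for Q
  proof (cases "P $ i $ j > 0")
    case True
    then have "Q $ i $ j > 0" using that by (simp add: sign_equiv_def)
    then show ?thesis using antisymmetric_rank_ge_2[of Q i j] that by simp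
  next
    case False
    then have "P $ j $ i > 0" using assms antisymmetric_nth[of P j i] by simp
    then have "Q $ j $ i > 0" using that by (simp add: sign_equiv_def)
    then show ?thesis using antisymmetric_rank_ge_2[of Q j i] that by simp
  qed
  have D: "antisymmetric (Disk u 1)" "Disk u 1 \<sim>\<^sub>s P"
    using antisymmetric_Disk sign_equiv_sym[OF assms(3)] by simp_all
  with ge rank_Disk_le[of u 1] show r: "rank (Disk u 1) = 2"
    by (simp add: order_antisym)
  show "sign_rank P = 2"
    unfolding sign_rank_def
  proof (rule Least_equality)
    show "\<exists>Q. antisymmetric Q \<and> Q \<sim>\<^sub>s P \<and> rank Q = 2"
      by (intro exI[of _ "Disk u 1"] conjI D r)
  qed (use ge in auto)
qed

lemma achieves_sign_rank_Disk_one_iff: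
  assumes "antisymmetric P" "P $ i $ j \<noteq> 0"
  shows "achieves_sign_rank (Disk u 1) P \<longleftrightarrow> P \<sim>\<^sub>s Disk u 1"
proof
  assume "P \<sim>\<^sub>s Disk u 1"
  then show "achieves_sign_rank (Disk u 1) P"
    using sign_rank_eq_2[OF assms, of u] antisymmetric_Disk[of u 1] sign_equiv_sym[of P "Disk u 1"]
    by (simp add: achieves_sign_rank_def)
qed (simp add: achieves_sign_rank_def sign_equiv_sym)

section \<open>Transitive games and numbers of wins\<close>

lemma regular_game_pos:
  assumes "antisymmetric P" "regular_game P" "\<not> P $ i $ j > 0" "i \<noteq> j"
  shows "P $ j $ i > 0"
proof -
  have "P $ i $ j < 0" using assms(2-) by (auto simp: regular_game_def less_le not_less)
  then show ?thesis using antisymmetric_nth[OF assms(1), of j i] by simp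
qed

lemma transitive_gameI:
  assumes "P \<sim>\<^sub>s Disk u 1"
  shows "transitive_game P"
  using assms unfolding sign_equiv_Disk_one transitive_game_def by force

text \<open>Whoever loses to \<open>j\<close> also loses to \<open>i\<close>, and \<open>j\<close>
  itself is an additional win of \<open>i\<close>.\<close>

lemma transitive_card_wins_less:
  fixes P :: "real^'n^'n"
  assumes "antisymmetric P" "transitive_game P" "P $ i $ j > 0"
  shows "card {k. P $ j $ k > 0} < card {k. P $ i $ k > 0}"
proof (rule psubset_card_mono)
  have "{k. P $ j $ k > 0} \<subseteq> {k. P $ i $ k > 0}"
    using assms(2,3) unfolding transitive_game_def by blast
  moreover have "j \<in> {k. P $ i $ k > 0}" "j \<notin> {k. P $ j $ k > 0}"
    using assms(3) antisymmetric_diag[OF assms(1)] by simp_all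
  ultimately show "{k. P $ j $ k > 0} \<subset> {k. P $ i $ k > 0}"
    by blast
qed simp

text \<open>A strict comparison in one direction is enough, because regularity makes \<open>P\<close> total.\<close>

lemma sign_equiv_Disk_oneI:
  assumes "antisymmetric P" "regular_game P"
    and "\<And>i j. P $ i $ j > 0 \<Longrightarrow> u $ j < u $ i"
  shows "P \<sim>\<^sub>s Disk u 1"
  unfolding sign_equiv_Disk_one
proof (intro allI iffI)
  fix i j assume less: "u $ j < u $ i"
  show "P $ i $ j > 0"
  proof (rule ccontr)
    assume "\<not> P $ i $ j > 0"
    moreover have "i \<noteq> j" using less by auto
    ultimately have "P $ j $ i > 0"
      by (rule regular_game_pos[OF assms(1,2)])
    then show False using assms(3)[of j i] less by simp
  qed
qed (rule assms(3))

text \<open>The number of wins is a witness free of parameters. It yields one direction of the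
  equivalence and sign rank two without Elo ratings.\<close>

lemma regular_transitive_sign_equiv_wins:
  fixes P :: "real^'n^'n"
  assumes "antisymmetric P" "regular_game P" "transitive_game P"
  shows "P \<sim>\<^sub>s Disk (\<chi> i. real (card {k. P $ i $ k > 0})) 1"
  using assms by (intro sign_equiv_Disk_oneI) (auto intro: transitive_card_wins_less)

section \<open>Elo ratings\<close>

lemma sigmoid_minus: "sigmoid (- x) = 1 - sigmoid x"
proof -
  have "1 + exp x > 0" by (simp add: add_pos_pos)
  then show ?thesis unfolding sigmoid_def exp_minus by (simp add: divide_simps add_eq_0_iff)
qed

lemma sigmoid_strict_mono: "x < y \<Longrightarrow> sigmoid x < sigmoid y"
  unfolding sigmoid_def by (intro less_imp_inverse_less) (auto simp: add_pos_pos)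

text \<open>In this form the loss is a combination of smooth terms \<open>ln (1 + exp z)\<close>,
  from which derivative, continuity and growth can be read off.\<close>

lemma bce_sigmoid: "bce y (sigmoid x) = y * ln (1 + exp (- x)) + (1 - y) * ln (1 + exp x)"
proof -
  have "1 - sigmoid x = inverse (1 + exp x)"
    using sigmoid_minus[of x] by (simp add: sigmoid_def)
  then show ?thesis
    unfolding bce_def by (simp add: sigmoid_def ln_inverse add_pos_pos)
qed

lemma has_real_derivative_bce_sigmoid:
  "((\<lambda>x. bce y (sigmoid x)) has_real_derivative sigmoid x - y) (at x)"
proof -
  have pos: "1 + exp x > 0" "1 + exp (- x) > 0" by (auto simp: add_pos_pos)
  have "((\<lambda>x. bce y (sigmoid x)) has_real_derivative
      - y * (exp (- x) / (1 + exp (- x))) + (1 - y) * (exp x / (1 + exp x))) (at x)"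
    unfolding bce_sigmoid using pos by (auto intro!: derivative_eq_intros simp: mult.commute)
  moreover have "exp (- x) / (1 + exp (- x)) = 1 - sigmoid x"
    using pos unfolding sigmoid_def by (simp add: divide_simps)
  moreover have "exp x / (1 + exp x) = sigmoid x"
    using pos unfolding sigmoid_def exp_minus by (simp add: divide_simps)
  ultimately show ?thesis by (simp add: algebra_simps)
qed

text \<open>The terms \<open>ln (1 + exp x)\<close> and \<open>ln (1 + exp (- x))\<close> are
  nonnegative, and one of them is at least \<open>\<bar>x\<bar>\<close>. With both weights at least
  \<open>m\<close>, the loss grows linearly.\<close>

lemma bce_sigmoid_ge:
  assumes "m \<le> y" "m \<le> 1 - y" "0 \<le> m"
  shows "m * \<bar>x\<bar> \<le> bce y (sigmoid x)"
proof -
  have l: "z \<le> ln (1 + exp z)" "0 \<le> ln (1 + exp z)" for z :: real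
    by (auto simp: ln_ge_iff add_pos_pos)
  have "m * \<bar>x\<bar> \<le> m * ln (1 + exp (- x)) + m * ln (1 + exp x)"
    unfolding distrib_left[symmetric]
    using l[of x] l[of "-x"] assms(3) by (intro mult_left_mono) linarith+
  also have "\<dots> \<le> bce y (sigmoid x)"
    unfolding bce_sigmoid using assms l by (intro add_mono mult_right_mono) auto
  finally show ?thesis .
qed

text \<open>Only the rating of player \<open>i\<close> is varied. By antisymmetry, row
  \<open>i\<close> and column \<open>i\<close> of the double sum contribute equally to the
  derivative.\<close>

lemma elo_rating_stationary:
  fixes P :: "real^'n^'n"
  assumes "antisymmetric P" "elo_rating P e"
  shows "(\<Sum>k\<in>UNIV. sigmoid (e $ i - e $ k)) = (\<Sum>k\<in>UNIV. (1 + P $ i $ k) / 2)"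
proof -
  \<comment> \<open>\<open>d a b\<close> is the derivative of the summand at \<open>(a, b)\<close>
    with respect to the rating difference; \<open>\<delta> a - \<delta> b\<close> is the speed of
    that difference along \<open>v\<close>.\<close>
  define d where "d a b = sigmoid (e $ a - e $ b) - (1 + P $ a $ b) / 2" for a b
  define \<delta> where "\<delta> a = (if a = i then 1 else 0 :: real)" for a
  define v where "v t = e + t *\<^sub>R axis i 1" for t :: real
  have v: "v t $ a - v t $ b = e $ a - e $ b + t * (\<delta> a - \<delta> b)" for t a b
    by (auto simp: v_def \<delta>_def axis_def algebra_simps)
  have "((\<lambda>t. bce ((1 + P $ a $ b) / 2) (sigmoid (e $ a - e $ b + t * (\<delta> a - \<delta> b))))
      has_real_derivative d a b * (\<delta> a - \<delta> b)) (at 0)" for a b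
    unfolding d_def
    by (rule DERIV_chain2[OF has_real_derivative_bce_sigmoid, THEN DERIV_cong])
      (auto intro!: derivative_eq_intros)
  then have "((\<lambda>t. elo_loss P (v t)) has_real_derivative
      (\<Sum>a\<in>UNIV. \<Sum>b\<in>UNIV. d a b * (\<delta> a - \<delta> b))) (at 0)"
    unfolding elo_loss_def v by (intro DERIV_sum)
  moreover have "\<forall>t. \<bar>0 - t\<bar> < 1 \<longrightarrow> elo_loss P (v 0) \<le> elo_loss P (v t)"
    using assms(2) by (auto simp: elo_rating_def is_arg_min_linorder v_def)
  ultimately have "(\<Sum>a\<in>UNIV. \<Sum>b\<in>UNIV. d a b * (\<delta> a - \<delta> b)) = 0"
    by (rule DERIV_local_min[OF _ zero_less_one])
  also have "(\<Sum>a\<in>UNIV. \<Sum>b\<in>UNIV. d a b * (\<delta> a - \<delta> b))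
      = (\<Sum>a\<in>UNIV. \<delta> a * (\<Sum>b\<in>UNIV. d a b)) - (\<Sum>a\<in>UNIV. \<Sum>b\<in>UNIV. d a b * \<delta> b)"
    by (simp add: right_diff_distrib sum_subtractf sum_distrib_left mult.commute)
  also have "(\<Sum>a\<in>UNIV. \<Sum>b\<in>UNIV. d a b * \<delta> b) = (\<Sum>a\<in>UNIV. d a i)"
    by (simp add: \<delta>_def if_distrib cong: if_cong)
  also have "(\<Sum>a\<in>UNIV. \<delta> a * (\<Sum>b\<in>UNIV. d a b)) = (\<Sum>b\<in>UNIV. d i b)"
    by (simp add: \<delta>_def if_distrib if_distribR cong: if_cong)
  \<comment> \<open>\<open>d\<close> is antisymmetric since both \<open>sigmoid\<close> and
    \<open>(1 + P) / 2\<close> turn into their complement to 1 when the players are swapped.\<close>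
  also have "(\<Sum>a\<in>UNIV. d a i) = (\<Sum>a\<in>UNIV. - d i a)"
  proof (rule sum.cong)
    fix a
    show "d a i = - d i a"
      using sigmoid_minus[of "e $ i - e $ a"] antisymmetric_nth[OF assms(1), of a i]
      by (simp add: d_def field_simps)
  qed simp
  finally have "(\<Sum>b\<in>UNIV. d i b) = 0" by (simp add: sum_negf)
  then show ?thesis by (simp add: d_def sum_subtractf)
qed

lemma elo_rating_less_iff:
  fixes P :: "real^'n^'n"
  assumes "antisymmetric P" "elo_rating P e"
  shows "e $ i < e $ j \<longleftrightarrow> (\<Sum>k\<in>UNIV. P $ i $ k) < (\<Sum>k\<in>UNIV. P $ j $ k)"
proof -
  define F where "F x = (\<Sum>k\<in>UNIV. sigmoid (x - e $ k))" for x
  have "strict_mono F"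
    unfolding F_def by (intro strict_monoI sum_strict_mono sigmoid_strict_mono) auto
  then have "e $ i < e $ j \<longleftrightarrow> F (e $ i) < F (e $ j)"
    by (simp add: strict_mono_less)
  also have "\<dots> \<longleftrightarrow> (\<Sum>k\<in>UNIV. P $ i $ k) < (\<Sum>k\<in>UNIV. P $ j $ k)"
    unfolding F_def elo_rating_stationary[OF assms]
    by (simp add: sum.distrib flip: sum_divide_distrib)
  finally show ?thesis .
qed

section \<open>Existence of Elo ratings\<close>

lemma continuous_on_elo_loss: "continuous_on A (elo_loss P)"
proof -
  have "1 + exp x \<noteq> 0" for x :: real
    by (metis add_pos_pos exp_gt_zero less_irrefl zero_less_one)
  then show ?thesis
    unfolding elo_loss_def bce_sigmoid by (intro continuous_intros) auto
qed

text \<open>Entries bounded away from -1 and 1 make the loss coercive in the rating differences. As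
  the loss is invariant under shifts, one rating can be set to zero, and the minimum over a compact
  box is global.\<close>

lemma elo_rating_exists:
  fixes P :: "real^'n^'n"
  assumes "c < 1" and P: "\<And>i j. \<bar>P $ i $ j\<bar> \<le> c"
  shows "\<exists>e. elo_rating P e"
proof -
  define m where "m = (1 - c) / 2"
  have m: "m > 0" using assms by (simp add: m_def)
  have Pm: "m \<le> (1 + P $ i $ j) / 2" "m \<le> 1 - (1 + P $ i $ j) / 2" for i j
    using P[of i j] by (auto simp: m_def field_simps)
  have nonneg: "0 \<le> bce ((1 + P $ a $ b) / 2) (sigmoid x)" for a b x
    by (rule order_trans[OF _ bce_sigmoid_ge[OF Pm]]) (use m in auto)
  have coercive: "m * \<bar>e $ i - e $ j\<bar> \<le> elo_loss P e" for e i j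
  proof -
    have "m * \<bar>e $ i - e $ j\<bar> \<le> bce ((1 + P $ i $ j) / 2) (sigmoid (e $ i - e $ j))"
      using Pm m by (intro bce_sigmoid_ge) auto
    also have "\<dots> \<le> (\<Sum>b\<in>UNIV. bce ((1 + P $ i $ b) / 2) (sigmoid (e $ i - e $ b)))"
      by (rule member_le_sum) (auto simp: nonneg)
    also have "\<dots> \<le> elo_loss P e"
      unfolding elo_loss_def
      by (rule member_le_sum[of i UNIV "\<lambda>a. \<Sum>b\<in>UNIV. bce ((1 + P $ a $ b) / 2) (sigmoid (e $ a - e $ b))"])
        (auto intro: sum_nonneg nonneg)
    finally show ?thesis .
  qed
  \<comment> \<open>A rating difference above \<open>R\<close> already costs more than the zero
    vector.\<close>
  define R where "R = elo_loss P 0 / m"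
  define K where "K = cbox (\<chi> i. - R) (\<chi> i. R :: real^'n)"
  have "R \<ge> 0" using coercive[of 0] m by (simp add: R_def)
  then have K0: "0 \<in> K" by (simp add: K_def mem_box_cart)
  then obtain e where e: "e \<in> K" "\<And>x. x \<in> K \<Longrightarrow> elo_loss P e \<le> elo_loss P x"
    using continuous_attains_inf[of K "elo_loss P"] continuous_on_elo_loss
    by (metis K_def compact_cbox empty_iff)
  have "elo_loss P e \<le> elo_loss P x" for x
  proof -
    fix i0 :: 'n
    define x' where "x' = (\<chi> i. x $ i - x $ i0)"
    have x': "elo_loss P x' = elo_loss P x"
      by (simp add: elo_loss_def x'_def)
    show ?thesis
    proof (cases "x' \<in> K")
      case True
      then show ?thesis using e(2) x' by metis
    next
      case False
      \<comment> \<open>Since \<open>x'\<close> vanishes at \<open>i0\<close>, a coordinate outside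
        the box is itself a rating difference larger than \<open>R\<close>.\<close>
      then obtain i where "R < \<bar>x' $ i - x' $ i0\<bar>"
        by (auto simp: K_def mem_box_cart x'_def not_le abs_if split: if_splits) (smt (verit))+
      then have "elo_loss P 0 < m * \<bar>x' $ i - x' $ i0\<bar>"
        using m by (simp add: R_def field_simps)
      with coercive[of x' i i0] e(2)[OF K0] x' show ?thesis by linarith
    qed
  qed
  then show ?thesis by (auto simp: elo_rating_def is_arg_min_linorder)
qed

section \<open>Row sums of regular transitive games\<close>

text \<open>The difference of the two sides vanishes at \<open>x = 0\<close>, and its derivative has
  the sign of \<open>cosh (t * a) - cosh (t * b)\<close>.\<close>

lemma sinh_superlinear:
  fixes a b x :: real
  assumes "0 < b" "b \<le> a" "0 \<le> x"
  shows "a * sinh (x * b) \<le> b * sinh (x * a)"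
proof -
  define f where "f t = b * sinh (t * a) - a * sinh (t * b)" for t
  have "f 0 \<le> f x"
  proof (rule DERIV_nonneg_imp_nondecreasing[OF assms(3)])
    fix t :: real assume t: "0 \<le> t" "t \<le> x"
    have "(f has_real_derivative a * b * (cosh (t * a) - cosh (t * b))) (at t)"
      unfolding f_def by (auto intro!: derivative_eq_intros simp: algebra_simps)
    moreover have "cosh (t * b) \<le> cosh (t * a)"
      using assms t by (intro cosh_real_nonneg_le_iff[THEN iffD2]) (auto intro: mult_left_mono)
    moreover from this have "0 \<le> a * b * (cosh (t * a) - cosh (t * b))"
      using assms by simp
    ultimately show "\<exists>y. (f has_real_derivative y) (at t) \<and> 0 \<le> y"
      by blast
  qed
  then show ?thesis by (simp add: f_def)
qed

text \<open>The logarithmic derivative of \<open>tanh (t * c)\<close> in \<open>t\<close> is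
  \<open>2 * c / sinh (2 * t * c)\<close>, which does not increase with \<open>c\<close> by
  \<open>sinh_superlinear\<close>. Hence the logarithm of the ratio does not increase in
  \<open>t\<close>.\<close>

lemma tanh_ratio_antimono:
  fixes a b x y :: real
  assumes "0 < b" "b \<le> a" "0 < x" "x \<le> y"
  shows "tanh (y * a) / tanh (y * b) \<le> tanh (x * a) / tanh (x * b)"
proof -
  define f where "f t = ln (tanh (t * a)) - ln (tanh (t * b))" for t
  have d: "((\<lambda>t. ln (tanh (t * c))) has_real_derivative 2 * c / sinh (2 * t * c)) (at t)"
    if "0 < c" "0 < t" for c t :: real
  proof -
    have pos: "0 < sinh (t * c)" "0 < cosh (t * c)" using that by auto
    have "1 - tanh (t * c) ^ 2 = (cosh (t * c) ^ 2 - sinh (t * c) ^ 2) / cosh (t * c) ^ 2"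
      using pos by (simp add: tanh_def power_divide diff_divide_distrib)
    also have "\<dots> = 1 / cosh (t * c) ^ 2"
      by (simp add: hyperbolic_pythagoras)
    finally have sech: "1 - tanh (t * c) ^ 2 = 1 / cosh (t * c) ^ 2" .
    have "(1 - tanh (t * c) ^ 2) * c / tanh (t * c) = 2 * c / sinh (2 * (t * c))"
      unfolding sech sinh_double unfolding tanh_def using pos by (simp add: divide_simps power2_eq_square)
    moreover have "((\<lambda>t. ln (tanh (t * c))) has_real_derivative
        (1 - tanh (t * c) ^ 2) * c / tanh (t * c)) (at t)"
      using that pos by (auto intro!: derivative_eq_intros)
    ultimately show ?thesis by (simp add: mult.assoc)
  qed
  have "f y \<le> f x"
  proof (rule DERIV_nonpos_imp_nonincreasing[OF assms(4)])
    fix t assume t: "x \<le> t" "t \<le> y"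
    have "(f has_real_derivative 2 * a / sinh (2 * t * a) - 2 * b / sinh (2 * t * b)) (at t)"
      unfolding f_def using t assms by (intro DERIV_diff d) auto
    moreover have "2 * a / sinh (2 * t * a) - 2 * b / sinh (2 * t * b) \<le> 0"
      using sinh_superlinear[of b a "2 * t"] assms t by (simp add: divide_simps mult_ac)
    ultimately show "\<exists>z. (f has_real_derivative z) (at t) \<and> z \<le> 0"
      by blast
  qed
  then have "ln (tanh (y * a) / tanh (y * b)) \<le> ln (tanh (x * a) / tanh (x * b))"
    using assms by (simp add: f_def ln_div)
  then show ?thesis using assms by (subst (asm) ln_le_cancel_iff) auto
qed

section \<open>Extreme entries and the comparison of row sums\<close>

lemma P_max_ge: "P $ i $ j \<le> P_max P"
proof -
  have "finite ((\<lambda>(i, j). P $ i $ j) ` UNIV)" by simp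
  moreover have "{P $ i $ j | i j. True} = (\<lambda>(i, j). P $ i $ j) ` UNIV" by auto
  ultimately show ?thesis unfolding P_max_def by (intro Max_ge) auto
qed

lemma P_min_le:
  assumes "0 < P $ i $ j"
  shows "P_min P \<le> P $ i $ j" "0 < P_min P"
proof -
  have sub: "{P $ i $ j | i j. P $ i $ j > 0} \<subseteq> (\<lambda>(i, j). P $ i $ j) ` UNIV" by auto
  have fin: "finite {P $ i $ j | i j. P $ i $ j > 0}"
    by (rule finite_subset[OF sub]) simp
  then show "P_min P \<le> P $ i $ j"
    unfolding P_min_def using assms by (intro Min_le) auto
  have "P_min P \<in> {P $ i $ j | i j. P $ i $ j > 0}"
    unfolding P_min_def using assms by (intro Min_in fin) auto
  then show "0 < P_min P" by auto
qed

text \<open>A row with value \<open>a\<close> per win, \<open>b\<close> per loss and 0 on the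
  diagonal. Taking \<open>(M, - m)\<close> and \<open>(m, - M)\<close> gives the extreme row sums
  compared below.\<close>

lemma sum_wins_losses:
  fixes P :: "real^'n^'n" and a b :: real
  assumes "antisymmetric P"
  shows "(\<Sum>k\<in>UNIV. if P $ i $ k > 0 then a else if k = i then 0 else b)
    = real (card {k. P $ i $ k > 0}) * (a - b) + (real CARD('n) - 1) * b"
proof -
  have "(if P $ i $ k > 0 then a else if k = i then 0 else b)
      = (if P $ i $ k > 0 then a - b else 0) + b - (if k = i then b else 0)" for k
    using antisymmetric_diag[OF assms, of i] by auto
  note summand = this
  show ?thesis
    unfolding summand by (simp add: sum.distrib sum_subtractf algebra_simps flip: sum.inter_filter)
qed

text \<open>The row of \<open>j\<close> is bounded as if its wins counted \<open>M\<close> and its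
  losses \<open>- m\<close>, the row of \<open>i\<close> as if its wins counted \<open>m\<close> and
  its losses \<open>- M\<close>. The extra win of \<open>i\<close> still outweighs this.\<close>

lemma tanh_row_sum_less:
  fixes P :: "real^'n^'n"
  assumes P: "antisymmetric P" "regular_game P" "transitive_game P"
    and "0 < \<beta>" "P $ i $ j > 0"
    and gap: "(real CARD('n) - 2) * tanh (\<beta> * P_max P) < real CARD('n) * tanh (\<beta> * P_min P)"
  shows "(\<Sum>k\<in>UNIV. tanh (\<beta> * P $ j $ k)) < (\<Sum>k\<in>UNIV. tanh (\<beta> * P $ i $ k))"
proof -
  define M where "M = tanh (\<beta> * P_max P)"
  define m where "m = tanh (\<beta> * P_min P)"
  define wins where "wins a = real (card {k. P $ a $ k > 0})" for a
  have hi: "tanh (\<beta> * P $ a $ b) \<le> M" for a b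
    using P_max_ge[of P a b] \<open>0 < \<beta>\<close> by (simp add: M_def)
  have lo: "m \<le> tanh (\<beta> * P $ a $ b)" if "P $ a $ b > 0" for a b
    using P_min_le(1)[OF that] \<open>0 < \<beta>\<close> by (simp add: m_def)
  have m0: "0 < m" "m \<le> M"
    using P_min_le(2)[OF assms(5)] order_trans[OF lo[OF assms(5)] hi] \<open>0 < \<beta>\<close>
    by (simp_all add: m_def)
  have neg: "tanh (\<beta> * P $ a $ b) = - tanh (\<beta> * P $ b $ a)" for a b
    using antisymmetric_nth[OF P(1), of a b] by (metis mult_minus_right tanh_minus)
  have pos: "P $ b $ a > 0" if "\<not> P $ a $ b > 0" "b \<noteq> a" for a b
    using regular_game_pos[OF P(1,2)] that by metis
  have "(\<Sum>k\<in>UNIV. tanh (\<beta> * P $ j $ k))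
      \<le> (\<Sum>k\<in>UNIV. if P $ j $ k > 0 then M else if k = j then 0 else - m)"
  proof (rule sum_mono)
    fix k
    show "tanh (\<beta> * P $ j $ k) \<le> (if P $ j $ k > 0 then M else if k = j then 0 else - m)"
      using hi[of j k] lo[of k j] pos[of j k] antisymmetric_diag[OF P(1), of j]
      by (cases "P $ j $ k > 0"; cases "k = j") (simp_all add: neg[of j k])
  qed
  also have "\<dots> = wins j * (M + m) - (real CARD('n) - 1) * m"
    by (simp add: sum_wins_losses[OF P(1)] wins_def)
  also have "\<dots> \<le> (wins i - 1) * (M + m) - (real CARD('n) - 1) * m"
    using transitive_card_wins_less[OF P(1,3) assms(5)] m0
    by (intro diff_right_mono mult_right_mono) (auto simp: wins_def)
  \<comment> \<open>The right side exceeds the left by exactly \<open>n * m - (n - 2) * M\<close>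
    with \<open>n = CARD('n)\<close>, which \<open>gap\<close> makes positive.\<close>
  also have "\<dots> < wins i * (m + M) - (real CARD('n) - 1) * M"
    using gap by (simp add: M_def m_def algebra_simps)
  also have "\<dots> = (\<Sum>k\<in>UNIV. if P $ i $ k > 0 then m else if k = i then 0 else - M)"
    by (simp add: sum_wins_losses[OF P(1)] wins_def)
  also have "\<dots> \<le> (\<Sum>k\<in>UNIV. tanh (\<beta> * P $ i $ k))"
  proof (rule sum_mono)
    fix k
    show "(if P $ i $ k > 0 then m else if k = i then 0 else - M) \<le> tanh (\<beta> * P $ i $ k)"
      using hi[of k i] lo[of i k] antisymmetric_diag[OF P(1), of i]
      by (cases "P $ i $ k > 0"; cases "k = i") (simp_all add: neg[of i k])
  qed
  finally show ?thesis .
qed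

text \<open>Monotonicity carries the ratio bound from \<open>\<beta>0\<close> to
  \<open>\<beta>\<close>. The positive term with \<open>\<alpha>\<close> in the denominator turns
  the weak inequality into a strict one.\<close>

lemma tanh_ratio_gap:
  fixes P :: "real^'n^'n"
  assumes "CARD('n) \<ge> 2" "P $ i $ j > 0" "0 < \<alpha>" "0 < \<beta>0" "\<beta>0 \<le> \<beta>"
    and ratio: "tanh (\<beta>0 * P_max P) / tanh (\<beta>0 * P_min P)
      \<le> real CARD('n) / (real CARD('n) - 2 + real CARD('n) * (real CARD('n) - 1) * \<alpha>)"
  shows "(real CARD('n) - 2) * tanh (\<beta> * P_max P) < real CARD('n) * tanh (\<beta> * P_min P)"
proof -
  define n where "n = real CARD('n)"
  have n: "n \<ge> 2" using assms(1) by (simp add: n_def)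
  have Pm: "0 < P_min P" "P_min P \<le> P_max P"
    using P_min_le[OF assms(2)] P_max_ge[of P i j] by auto
  have t: "0 < tanh (\<beta> * P_min P)" "0 < tanh (\<beta> * P_max P)" using Pm assms by auto
  have p: "0 < n * (n - 1) * \<alpha>" using n assms by simp
  have "tanh (\<beta> * P_max P) / tanh (\<beta> * P_min P) \<le> n / (n - 2 + n * (n - 1) * \<alpha>)"
    using tanh_ratio_antimono[OF Pm assms(4,5)] ratio by (simp add: n_def)
  moreover have "0 < n - 2 + n * (n - 1) * \<alpha>" using n p by linarith
  ultimately have "tanh (\<beta> * P_max P) * (n - 2 + n * (n - 1) * \<alpha>) \<le> n * tanh (\<beta> * P_min P)"
    using t by (simp add: divide_simps split: if_splits)
  moreover have "0 < tanh (\<beta> * P_max P) * (n * (n - 1) * \<alpha>)" using t p by simp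
  ultimately show ?thesis by (simp add: n_def algebra_simps)
qed

section \<open>The transformed game and the conclusion\<close>

lemma antisymmetric_map_phi:
  assumes "antisymmetric P"
  shows "antisymmetric (map_matrix (phi \<beta>) P)"
  unfolding antisymmetric_iff
proof (intro allI)
  fix i j
  show "map_matrix (phi \<beta>) P $ i $ j = - map_matrix (phi \<beta>) P $ j $ i"
    by (simp add: phi_def antisymmetric_nth[OF assms, of i j])
qed

lemma abs_phi_le:
  assumes "0 < \<beta>"
  shows "\<bar>phi \<beta> x\<bar> \<le> 1 / \<beta>"
proof -
  have "\<bar>tanh (\<beta> * x)\<bar> \<le> 1" using tanh_real_bounds[of "\<beta> * x"] by auto
  then show ?thesis using assms by (simp add: phi_def abs_mult divide_right_mono)
qed

text \<open>The second conjunct justifies reading "achieves the sign-rank" as sign equivalence.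
  Existence of a rating is stated separately so that the claim about all ratings is not
  vacuous.\<close>

theorem corollary2p1:
  fixes P :: "real^'n^'n"
  assumes "CARD('n) \<ge> 2" and "is_game P" and "regular_game P"
  shows "(transitive_game P \<longleftrightarrow> (\<exists>u :: real^'n. achieves_sign_rank (Disk u 1) P)) \<and>
         (\<forall>u :: real^'n. achieves_sign_rank (Disk u 1) P \<longleftrightarrow> P \<sim>\<^sub>s Disk u 1) \<and>
         (transitive_game P \<longrightarrow>
            sign_rank P = 2 \<and>
            (\<forall>\<alpha> \<beta>\<^sub>\<alpha> \<beta> :: real.
               0 < \<alpha> \<and> \<alpha> < 2 / (real CARD('n) * (real CARD('n) - 1)) \<and>
               0 < \<beta>\<^sub>\<alpha> \<and>
               tanh (\<beta>\<^sub>\<alpha> * P_max P) / tanh (\<beta>\<^sub>\<alpha> * P_min P)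
                 \<le> real CARD('n)
                    / (real CARD('n) - 2 + real CARD('n) * (real CARD('n) - 1) * \<alpha>) \<and>
               \<beta> > max ((real CARD('n) - 1) / x_alpha \<alpha>) \<beta>\<^sub>\<alpha>
               \<longrightarrow> (\<exists>u. elo_rating (map_matrix (phi \<beta>) P) u) \<and>
                   (\<forall>u. elo_rating (map_matrix (phi \<beta>) P) u
                        \<longrightarrow> achieves_sign_rank (Disk u 1) P)))"
proof (intro conjI impI allI)
  have anti: "antisymmetric P" using assms(2) by (simp add: is_game_def)
  obtain i j :: 'n where "i \<noteq> j"
    using assms(1) by (metis card_le_Suc0_iff_eq finite not_less_eq_eq numeral_2_eq_2)
  then have ne: "P $ i $ j \<noteq> 0" using assms(3) by (simp add: regular_game_def)
  note achieves_iff = achieves_sign_rank_Disk_one_iff[OF anti ne]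
  show "achieves_sign_rank (Disk u 1) P \<longleftrightarrow> P \<sim>\<^sub>s Disk u 1" for u
    by (rule achieves_iff)
  note equiv_wins = regular_transitive_sign_equiv_wins[OF anti assms(3)]
  show "transitive_game P \<longleftrightarrow> (\<exists>u :: real^'n. achieves_sign_rank (Disk u 1) P)"
    using achieves_iff equiv_wins transitive_gameI by blast
  assume trans: "transitive_game P"
  show "sign_rank P = 2"
    using sign_rank_eq_2(1)[OF anti ne equiv_wins[OF trans]] .
  fix \<alpha> \<beta>\<^sub>\<alpha> \<beta> :: real
  assume params: "0 < \<alpha> \<and> \<alpha> < 2 / (real CARD('n) * (real CARD('n) - 1)) \<and> 0 < \<beta>\<^sub>\<alpha> \<and>
    tanh (\<beta>\<^sub>\<alpha> * P_max P) / tanh (\<beta>\<^sub>\<alpha> * P_min P)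
      \<le> real CARD('n) / (real CARD('n) - 2 + real CARD('n) * (real CARD('n) - 1) * \<alpha>) \<and>
    \<beta> > max ((real CARD('n) - 1) / x_alpha \<alpha>) \<beta>\<^sub>\<alpha>"
  have "0 < x_alpha \<alpha>" "x_alpha \<alpha> < 1"
    using theI'[OF x_alpha_ex1[of \<alpha>]] params unfolding x_alpha_def by auto
  \<comment> \<open>This gives \<open>\<beta> > 1\<close>, so the entries of the transformed game
    are at most \<open>1 / \<beta> < 1\<close> in absolute value and a minimizer exists.\<close>
  then have "1 \<le> (real CARD('n) - 1) / x_alpha \<alpha>"
    using assms(1) by (simp add: field_simps)
  then have \<beta>: "1 < \<beta>" "\<beta>\<^sub>\<alpha> \<le> \<beta>" using params by auto
  let ?Q = "map_matrix (phi \<beta>) P"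
  show "\<exists>u. elo_rating ?Q u"
    using \<beta> by (intro elo_rating_exists[of "1 / \<beta>"]) (auto intro!: abs_phi_le)
  fix u assume u: "elo_rating ?Q u"
  have "u $ b < u $ a" if "P $ a $ b > 0" for a b
  proof -
    have "(\<Sum>k\<in>UNIV. tanh (\<beta> * P $ b $ k)) < (\<Sum>k\<in>UNIV. tanh (\<beta> * P $ a $ k))"
      using \<beta> params tanh_ratio_gap[OF assms(1) that, of \<alpha> \<beta>\<^sub>\<alpha> \<beta>]
      by (intro tanh_row_sum_less anti assms(3) trans that) auto
    \<comment> \<open>Row sums of the transformed game are those of
      \<open>tanh (\<beta> * P)\<close> divided by the positive \<open>\<beta>\<close>.\<close>
    then show ?thesis
      unfolding elo_rating_less_iff[OF antisymmetric_map_phi[OF anti] u]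
      using \<beta> by (simp add: phi_def divide_strict_right_mono flip: sum_divide_distrib)
  qed
  then show "achieves_sign_rank (Disk u 1) P"
    unfolding achieves_iff by (intro sign_equiv_Disk_oneI anti assms(3))
qed

end
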